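(* The maximum rank oracle (Max) is not polynomially reducible to any of the following: the minimum rank oracle (Min), the rank sum oracle (Sum), and the common independence oracle (CI).
   Context: Let $\mathbf{M}_1=(E,\mathcal{I}_1)$, $\mathbf{M}_2=(E,\mathcal{I}_2)$ be loopless matroids on a common finite ground set $E$ with rank functions $r_1,r_2$. For a queried $X\subseteq E$: Sum returns $r_1(X)+r_2(X)$; Min returns $\min\{r_1(X),r_2(X)\}$; Max returns $\max\{r_1(X),r_2(X)\}$; CI returns ``Yes'' if $X\in\mathcal{I}_1\cap\mathcal{I}_2$ and ``No'' otherwise. An oracle $\mathcal{O}_1$ is polynomially reducible to an oracle $\mathcal{O}_2$ if, for every such pair of matroids, the answer of $\mathcal{O}_1$ to any query can be computed using a number of calls to $\mathcal{O}_2$ bounded by a polynomial in $|E|$ (in particular, the answers of $\mathcal{O}_2$ must determine those of $\mathcal{O}_1$). *)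

theory Defs
  imports Main "HOL-Library.Infinite_Typeclass" "HOL-Computational_Algebra.Polynomial"
begin

locale matroid =
  fixes E :: "'a set" and \<I> :: "'a set set"
  assumes finite_ground: "finite E"
    and indep_subset_ground: "X \<in> \<I> \<Longrightarrow> X \<subseteq> E"
    and indep_empty: "{} \<in> \<I>"
    and indep_subset: "X \<in> \<I> \<Longrightarrow> Y \<subseteq> X \<Longrightarrow> Y \<in> \<I>"
    and indep_augment:
      "X \<in> \<I> \<Longrightarrow> Y \<in> \<I> \<Longrightarrow> card X < card Y \<Longrightarrow> \<exists>e \<in> Y - X. insert e X \<in> \<I>"

locale loopless_matroid = matroid +
  assumes loopless: "e \<in> E \<Longrightarrow> {e} \<in> \<I>"

definition matroid_rank :: "'a set set \<Rightarrow> 'a set \<Rightarrow> nat" where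
  "matroid_rank \<I> X = Max (card ` {Y \<in> \<I>. Y \<subseteq> X})"

text \<open>Oracles for pairs of matroids on a common ground set: each matroid is given by its family
  of independent sets, the third argument is the queried set.\<close>

type_synonym ('a, 'b) matroid_oracle = "'a set set \<Rightarrow> 'a set set \<Rightarrow> 'a set \<Rightarrow> 'b"

definition sum_oracle :: "('a, nat) matroid_oracle" where
  "sum_oracle \<I>\<^sub>1 \<I>\<^sub>2 X = matroid_rank \<I>\<^sub>1 X + matroid_rank \<I>\<^sub>2 X"

definition min_oracle :: "('a, nat) matroid_oracle" where
  "min_oracle \<I>\<^sub>1 \<I>\<^sub>2 X = min (matroid_rank \<I>\<^sub>1 X) (matroid_rank \<I>\<^sub>2 X)"

definition max_oracle :: "('a, nat) matroid_oracle" where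
  "max_oracle \<I>\<^sub>1 \<I>\<^sub>2 X = max (matroid_rank \<I>\<^sub>1 X) (matroid_rank \<I>\<^sub>2 X)"

definition ci_oracle :: "('a, bool) matroid_oracle" where
  "ci_oracle \<I>\<^sub>1 \<I>\<^sub>2 X \<longleftrightarrow> X \<in> \<I>\<^sub>1 \<inter> \<I>\<^sub>2"

text \<open>A deterministic adaptive computation is a decision tree: every query may depend on the
  answers received so far.  Only queries are counted; the work between two queries is not
  restricted.\<close>

datatype ('a, 'b, 'c) computation =
    Return 'c
  | Query "'a set" "'b \<Rightarrow> ('a, 'b, 'c) computation"

primrec computation_result :: "('a set \<Rightarrow> 'b) \<Rightarrow> ('a, 'b, 'c) computation \<Rightarrow> 'c" where
  "computation_result f (Return c) = c"
| "computation_result f (Query X k) = computation_result f (k (f X))"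

primrec computation_queries :: "('a set \<Rightarrow> 'b) \<Rightarrow> ('a, 'b, 'c) computation \<Rightarrow> 'a set list" where
  "computation_queries f (Return c) = []"
| "computation_queries f (Query X k) = X # computation_queries f (k (f X))"

text \<open>The algorithm \<open>A\<close> knows the ground set \<open>E\<close> and the set \<open>X\<close> for which the answer of \<open>\<O>\<^sub>1\<close> is
  wanted, but it has access to the two matroids only through \<open>\<O>\<^sub>2\<close>.  The type of elements is
  infinite so that ground sets of every finite size occur.\<close>

definition polynomially_reducible ::
    "('a::infinite, 'c) matroid_oracle \<Rightarrow> ('a, 'b) matroid_oracle \<Rightarrow> bool" where
  "polynomially_reducible \<O>\<^sub>1 \<O>\<^sub>2 \<longleftrightarrow>
    (\<exists>(p :: nat poly) (A :: 'a set \<Rightarrow> 'a set \<Rightarrow> ('a, 'b, 'c) computation).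
      \<forall>E \<I>\<^sub>1 \<I>\<^sub>2 X. loopless_matroid E \<I>\<^sub>1 \<longrightarrow> loopless_matroid E \<I>\<^sub>2 \<longrightarrow> X \<subseteq> E \<longrightarrow>
        computation_result (\<O>\<^sub>2 \<I>\<^sub>1 \<I>\<^sub>2) (A E X) = \<O>\<^sub>1 \<I>\<^sub>1 \<I>\<^sub>2 X \<and>
        set (computation_queries (\<O>\<^sub>2 \<I>\<^sub>1 \<I>\<^sub>2) (A E X)) \<subseteq> Pow E \<and>
        length (computation_queries (\<O>\<^sub>2 \<I>\<^sub>1 \<I>\<^sub>2) (A E X)) \<le> poly p (card E))"

end

theory Submission
  imports Defs
begin

text \<open>Already the answers of the weaker oracles do not determine those of Max. The witnesses are
  partition matroids in which two elements may be parallel. If \<open>M\<close> has rank one and \<open>F\<close> is free on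
  two elements, then \<open>(M, M)\<close> and \<open>(M, F)\<close> have the same minimum ranks and the same common
  independent sets, but maximum ranks 1 and 2. For Sum, take two copies of the two-element set: the
  pairs \<open>(M \<oplus> M, F \<oplus> F)\<close> and \<open>(M \<oplus> F, F \<oplus> M)\<close> have the same rank sums, but maximum ranks 4
  and 3.\<close>

text \<open>A computation sees the matroids only through its oracle, so pairs with equal oracles
  yield the same result.\<close>

lemma not_polynomially_reducibleI:
  assumes "loopless_matroid E \<I>\<^sub>1" "loopless_matroid E \<I>\<^sub>2"
    and "loopless_matroid E \<J>\<^sub>1" "loopless_matroid E \<J>\<^sub>2"
    and "X \<subseteq> E"
    and "\<O>\<^sub>2 \<I>\<^sub>1 \<I>\<^sub>2 = \<O>\<^sub>2 \<J>\<^sub>1 \<J>\<^sub>2"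
    and "\<O>\<^sub>1 \<I>\<^sub>1 \<I>\<^sub>2 X \<noteq> \<O>\<^sub>1 \<J>\<^sub>1 \<J>\<^sub>2 X"
  shows "\<not> polynomially_reducible \<O>\<^sub>1 \<O>\<^sub>2"
  using assms unfolding polynomially_reducible_def by metis

text \<open>The partition matroid on \<open>E\<close> whose classes are the fibres of
  \<open>f\<close>: \<open>id\<close> gives the free matroid, and \<open>id(b := a)\<close> makes
  \<open>a\<close> and \<open>b\<close> parallel.\<close>

definition transversal_indep :: "'a set \<Rightarrow> ('a \<Rightarrow> 'b) \<Rightarrow> 'a set set" where
  "transversal_indep E f = {X. X \<subseteq> E \<and> inj_on f X}"

text \<open>For augmentation, the larger set has more values under \<open>f\<close>, so one of its
  elements has a value not yet taken.\<close>

lemma loopless_matroid_transversal_indep: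
  assumes "finite E"
  shows "loopless_matroid E (transversal_indep E f)"
proof
  fix X Y
  assume X: "X \<in> transversal_indep E f" and Y: "Y \<in> transversal_indep E f"
    and less: "card X < card Y"
  have "finite X"
    using X assms by (auto simp: transversal_indep_def intro: finite_subset)
  moreover have "card (f ` X) < card (f ` Y)"
    using X Y less by (simp add: transversal_indep_def card_image)
  ultimately have "\<not> f ` Y \<subseteq> f ` X"
    using card_mono[of "f ` X" "f ` Y"] by auto
  then obtain e where "e \<in> Y" "f e \<notin> f ` X"
    by auto
  then show "\<exists>e \<in> Y - X. insert e X \<in> transversal_indep E f"
    using X Y by (intro bexI[of _ e]) (auto simp: transversal_indep_def)
qed (use assms in \<open>auto simp: transversal_indep_def intro: inj_on_subset\<close>)

text \<open>One representative from each fibre meeting \<open>X\<close> forms a largest independent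
  subset.\<close>

lemma matroid_rank_transversal_indep:
  assumes "finite E"
  shows "matroid_rank (transversal_indep E f) X = card (f ` (X \<inter> E))"
  unfolding matroid_rank_def
proof (rule Max_eqI)
  have "{Y \<in> transversal_indep E f. Y \<subseteq> X} \<subseteq> Pow E"
    by (auto simp: transversal_indep_def)
  then show "finite (card ` {Y \<in> transversal_indep E f. Y \<subseteq> X})"
    using assms finite_subset by blast
next
  fix n
  assume "n \<in> card ` {Y \<in> transversal_indep E f. Y \<subseteq> X}"
  then obtain Y where Y: "Y \<subseteq> X \<inter> E" "inj_on f Y" "n = card Y"
    by (auto simp: transversal_indep_def)
  then have "n = card (f ` Y)"
    by (simp add: card_image)
  also have "\<dots> \<le> card (f ` (X \<inter> E))"
    using Y assms by (intro card_mono) auto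
  finally show "n \<le> card (f ` (X \<inter> E))" .
next
  obtain Y where "Y \<subseteq> X \<inter> E" "inj_on f Y" "f ` (X \<inter> E) = f ` Y"
    using subset_image_inj[of "f ` (X \<inter> E)" f "X \<inter> E"] by auto
  then show "card (f ` (X \<inter> E)) \<in> card ` {Y \<in> transversal_indep E f. Y \<subseteq> X}"
    by (intro image_eqI[of _ _ Y]) (auto simp: transversal_indep_def card_image)
qed

theorem theorem3p4:
  shows "\<not> polynomially_reducible (max_oracle :: ('a::infinite, nat) matroid_oracle) (min_oracle :: ('a, nat) matroid_oracle) \<and>
         \<not> polynomially_reducible (max_oracle :: ('a, nat) matroid_oracle) (sum_oracle :: ('a, nat) matroid_oracle) \<and>
         \<not> polynomially_reducible (max_oracle :: ('a, nat) matroid_oracle) (ci_oracle :: ('a, bool) matroid_oracle)"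
proof -
  obtain S :: "'a set" where "card S = 4"
    using infinite_arbitrarily_large[OF infinite_UNIV] by blast
  \<comment> \<open>The reversed list supplies the inequalities in the other orientation for the
    simplifier.\<close>
  then obtain a b c d :: 'a where neq: "distinct [a, b, c, d]" "distinct [d, c, b, a]"
    by (auto simp: card_Suc_eq numeral_eq_Suc)
  note loopless = loopless_matroid_transversal_indep
  note rank = matroid_rank_transversal_indep
  define M :: "'a set set" where "M = transversal_indep {a, b} (id(b := a))"
  define F :: "'a set set" where "F = transversal_indep {a, b} id"
  have loopless_MF: "loopless_matroid {a, b} M" "loopless_matroid {a, b} F"
    by (simp_all add: M_def F_def loopless)
  have max_MF: "max_oracle M M {a, b} \<noteq> max_oracle M F {a, b}"
    using neq by (simp add: max_oracle_def M_def F_def rank)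
  have "min_oracle M M = min_oracle M F"
  proof
    fix X
    \<comment> \<open>The rank of \<open>M\<close> never exceeds that of \<open>F\<close>, so both
      minima are the rank of \<open>M\<close>.\<close>
    have "card ((id(b := a)) ` (X \<inter> {a, b})) \<le> card (id ` (X \<inter> {a, b}))"
      unfolding image_id id_apply by (rule card_image_le) simp
    then show "min_oracle M M X = min_oracle M F X"
      unfolding min_oracle_def M_def F_def by (simp only: rank finite.intros min_absorb1 order_refl)
  qed
  then have Min: "\<not> polynomially_reducible (max_oracle :: ('a, nat) matroid_oracle) min_oracle"
    using loopless_MF max_MF by (intro not_polynomially_reducibleI[where X = "{a, b}"]) auto
  have "ci_oracle M M = ci_oracle M F"
    by (auto simp: fun_eq_iff ci_oracle_def M_def F_def transversal_indep_def)
  then have CI: "\<not> polynomially_reducible (max_oracle :: ('a, nat) matroid_oracle) ci_oracle"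
    using loopless_MF max_MF by (intro not_polynomially_reducibleI[where X = "{a, b}"]) auto
  define E where "E = {a, b, c, d}"
  define I :: "('a \<Rightarrow> 'a) \<Rightarrow> 'a set set" where "I = transversal_indep E"
  have "finite E"
    by (simp add: E_def)
  have Sum: "\<not> polynomially_reducible (max_oracle :: ('a, nat) matroid_oracle) sum_oracle"
  proof (rule not_polynomially_reducibleI[where E = E])
    \<comment> \<open>The blocks are \<open>{a, b}\<close> and \<open>{c, d}\<close>; updating at
      \<open>b\<close> or at \<open>d\<close> makes the respective block parallel.\<close>
    show "sum_oracle (I (id(b := a, d := c))) (I id) = sum_oracle (I (id(b := a))) (I (id(d := c)))"
    proof
      fix X
      \<comment> \<open>The ranks depend only on the trace of \<open>X\<close> on \<open>E\<close>,
        which leaves sixteen cases.\<close>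
      have "X \<inter> E \<in> Pow {a, b, c, d}"
        by (simp add: E_def)
      then show "sum_oracle (I (id(b := a, d := c))) (I id) X =
          sum_oracle (I (id(b := a))) (I (id(d := c))) X"
        unfolding sum_oracle_def I_def rank[OF \<open>finite E\<close>] using neq
        by (simp add: Pow_insert) (elim disjE; simp add: card_insert_if)
    qed
    \<comment> \<open>On all of \<open>E\<close> the ranks are 2 and 4 in the first pair, 3 and 3 in
      the second.\<close>
    show "max_oracle (I (id(b := a, d := c))) (I id) E \<noteq>
        max_oracle (I (id(b := a))) (I (id(d := c))) E"
      unfolding max_oracle_def I_def rank[OF \<open>finite E\<close>] using neq
      by (simp add: E_def card_insert_if)
  qed (simp_all add: I_def loopless \<open>finite E\<close>)
  show ?thesis
    using Min Sum CI by blast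
qed

end
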